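(* For $\alpha\in(0,1)$ let $$w_\alpha(x,t)=1-\frac{1-W\left(-\frac{x}{t^{\alpha/2}},-\frac{\alpha}{2},1\right)}{1-W\left(-2\eta_\alpha,-\frac{\alpha}{2},1\right)},\qquad r_\alpha(t)=2\eta_\alpha t^{\alpha/2},$$ where $\eta_\alpha$ is the unique solution of $$2x\left[1-W\left(-2x,-\tfrac{\alpha}{2},1\right)\right]=M_{\alpha/2}(2x)\,\frac{\Gamma(1-\alpha/2)}{\Gamma(1+\alpha/2)},\qquad x>0,$$ and let $$u_\alpha(x,t)=1-\frac{1-W\left(-\frac{x}{t^{\alpha/2}},-\frac{\alpha}{2},1\right)}{1-W\left(-2\xi_\alpha,-\frac{\alpha}{2},1\right)},\qquad s_\alpha(t)=2\xi_\alpha t^{\alpha/2},$$ where $\xi_\alpha$ is the unique solution of $$2x\left[1-W\left(-2x,-\tfrac{\alpha}{2},1\right)\right]=2x\,W\left(-2x,-\tfrac{\alpha}{2},1\right)+W\left(-2x,-\tfrac{\alpha}{2},1+\tfrac{\alpha}{2}\right),\qquad x>0.$$ Let $T>0$ and let $\{u,s\}$ be the unique solution of the classical Stefan problem $$\begin{array}{ll} u_t(x,t)=\frac{\partial^2 u}{\partial x^2}(x,t), & 0<x<s(t),\ 0<t<T,\\ u(0,t)=1, & 0<t\le T,\\ u(s(t),t)=0, & 0<t\le T,\quad s(0)=0,\\ s'(t)=-u_x(s(t),t), & 0<t\le T.\end{array}$$ Then, as $\alpha\nearrow 1$, both $\{w_\alpha,r_\alpha\}$ and $\{u_\alpha,s_\alpha\}$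 converge (pointwise) to $\{u,s\}$; that is, for $0<t\le T$ and $0\le x\le s(t)$, $$\lim_{\alpha\nearrow1}w_\alpha(x,t)=\lim_{\alpha\nearrow1}u_\alpha(x,t)=u(x,t),\qquad \lim_{\alpha\nearrow1}r_\alpha(t)=\lim_{\alpha\nearrow1}s_\alpha(t)=s(t).$$
   Context: $\Gamma$ is the Gamma function, and $1/\Gamma$ is taken to be $0$ at the poles of $\Gamma$. The Wright function is $W(x,\rho,\beta)=\sum_{k=0}^{\infty}\frac{x^k}{k!\,\Gamma(\rho k+\beta)}$ for $x\in\mathbb{R}$, $\rho>-1$, $\beta\in\mathbb{R}$. The Mainardi function is $M_\rho(x)=W(-x,-\rho,1-\rho)$ for $0<\rho<1$. The formulas for $w_\alpha$ and $u_\alpha$ are regarded as defined for all $x\ge 0$, $t>0$. It is known from earlier work that, for each $\alpha\in(0,1)$, the equations for $\eta_\alpha$ and $\xi_\alpha$ each have exactly one positive solution. (The pairs $\{w_\alpha,r_\alpha\}$ and $\{u_\alpha,s_\alpha\}$ are solutions of two fractional Stefan problems, formulated with the Caputo derivative and the Riemann–Liouville derivative respectively.) It is classical that the unique solution of the classical Stefan problem in the claim is $$u(x,t)=1-\frac{\operatorname{erf}\left(\frac{x}{2\sqrt t}\right)}{\operatorname{erf}(\eta_1)},\qquad s(t)=2\eta_1\sqrt t,$$ where $\eta_1>0$ is the unique positive solution of $\eta_1\operatorname{erf}(\eta_1)=\frac{e^{-\eta_1^2}}{\sqrt\pi}$ and $\operatorname{erf}(x)=\frac{2}{\sqrt\pi}\int_0^x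 e^{-z^2}\,dz$. *)

theory Defs
  imports "HOL-Analysis.Analysis"
begin

text \<open>The library function \<^const>\<open>rGamma\<close> is the entire reciprocal \<open>1/\<Gamma>\<close>,
  which vanishes at the poles of \<open>\<Gamma>\<close>.\<close>

definition Wright :: "real \<Rightarrow> real \<Rightarrow> real \<Rightarrow> real" where
  "Wright x \<rho> \<beta> = (\<Sum>k. x ^ k / fact k * rGamma (\<rho> * real k + \<beta>))"

definition Mainardi :: "real \<Rightarrow> real \<Rightarrow> real" where
  "Mainardi \<rho> x = Wright (- x) (- \<rho>) (1 - \<rho>)"

text \<open>Both fractional problems have solutions of the same similarity form; they differ only in
  the coefficient \<open>c\<close> of the free boundary.\<close>

definition frac_temp :: "real \<Rightarrow> real \<Rightarrow> real \<Rightarrow> real \<Rightarrow> real" where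
  "frac_temp \<alpha> c x t =
     1 - (1 - Wright (- (x / t powr (\<alpha> / 2))) (- (\<alpha> / 2)) 1)
       / (1 - Wright (- (2 * c)) (- (\<alpha> / 2)) 1)"

definition frac_front :: "real \<Rightarrow> real \<Rightarrow> real \<Rightarrow> real" where
  "frac_front \<alpha> c t = 2 * c * t powr (\<alpha> / 2)"

text \<open>Equation for the coefficient in the Caputo case.\<close>

definition eta_equation :: "real \<Rightarrow> real \<Rightarrow> bool" where
  "eta_equation \<alpha> x \<longleftrightarrow>
     2 * x * (1 - Wright (- (2 * x)) (- (\<alpha> / 2)) 1)
       = Mainardi (\<alpha> / 2) (2 * x) * (Gamma (1 - \<alpha> / 2) / Gamma (1 + \<alpha> / 2))"

text \<open>Equation for the coefficient in the Riemann--Liouville case.\<close>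

definition xi_equation :: "real \<Rightarrow> real \<Rightarrow> bool" where
  "xi_equation \<alpha> x \<longleftrightarrow>
     2 * x * (1 - Wright (- (2 * x)) (- (\<alpha> / 2)) 1)
       = 2 * x * Wright (- (2 * x)) (- (\<alpha> / 2)) 1
         + Wright (- (2 * x)) (- (\<alpha> / 2)) (1 + \<alpha> / 2)"

definition unique_positive_solution :: "(real \<Rightarrow> bool) \<Rightarrow> real \<Rightarrow> bool" where
  "unique_positive_solution P x \<longleftrightarrow> 0 < x \<and> P x \<and> (\<forall>y>0. P y \<longrightarrow> y = x)"

text \<open>Classical solutions of the one-phase Stefan problem with \<open>s(0) = 0\<close>.
  The regularity is the usual one: \<open>s\<close> is positive, continuous on \<open>[0,T]\<close> and \<open>C\<^sup>1\<close> on \<open>(0,T]\<close>;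
  \<open>u\<close> is \<open>C\<^sup>2\<close> in \<open>x\<close> and \<open>C\<^sup>1\<close> in \<open>t\<close> inside the domain, and continuous up to the boundary
  except at the corner \<open>(0,0)\<close>, where the boundary data jump and only boundedness is required.
  (Without continuity up to the boundary and boundedness the boundary data would not
  determine \<open>u\<close>.)  The derivative \<open>u\<^sub>x(s(t),t)\<close> is taken from inside the domain, and \<open>s'(T)\<close> from
  the left.  Values of \<open>u\<close> outside \<open>0 \<le> x \<le> s(t)\<close> and of \<open>s\<close> outside \<open>[0,T]\<close> are irrelevant.\<close>

definition stefan_interior :: "real \<Rightarrow> (real \<Rightarrow> real) \<Rightarrow> (real \<times> real) set" where
  "stefan_interior T s = {(x, t). 0 < t \<and> t < T \<and> 0 < x \<and> x < s t}"

definition stefan_region :: "real \<Rightarrow> (real \<Rightarrow> real) \<Rightarrow> (real \<times> real) set" where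
  "stefan_region T s = {(x, t). 0 < t \<and> t \<le> T \<and> 0 \<le> x \<and> x \<le> s t}"

definition heat_equation_on :: "(real \<times> real) set \<Rightarrow> (real \<Rightarrow> real \<Rightarrow> real) \<Rightarrow> bool" where
  "heat_equation_on D u \<longleftrightarrow>
     (\<exists>u\<^sub>t u\<^sub>x u\<^sub>x\<^sub>x :: real \<Rightarrow> real \<Rightarrow> real.
        (\<forall>(x, t)\<in>D.
           ((\<lambda>\<tau>. u x \<tau>) has_real_derivative u\<^sub>t x t) (at t) \<and>
           ((\<lambda>y. u y t) has_real_derivative u\<^sub>x x t) (at x) \<and>
           ((\<lambda>y. u\<^sub>x y t) has_real_derivative u\<^sub>x\<^sub>x x t) (at x) \<and>
           u\<^sub>t x t = u\<^sub>x\<^sub>x x t) \<and>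
        continuous_on D (\<lambda>(x, t). u\<^sub>t x t) \<and>
        continuous_on D (\<lambda>(x, t). u\<^sub>x x t) \<and>
        continuous_on D (\<lambda>(x, t). u\<^sub>x\<^sub>x x t))"

definition stefan_solution ::
  "real \<Rightarrow> (real \<Rightarrow> real \<Rightarrow> real) \<Rightarrow> (real \<Rightarrow> real) \<Rightarrow> bool" where
  "stefan_solution T u s \<longleftrightarrow>
     continuous_on {0..T} s \<and> (\<forall>t\<in>{0<..T}. 0 < s t) \<and>
     continuous_on (stefan_region T s) (\<lambda>(x, t). u x t) \<and>
     bounded ((\<lambda>(x, t). u x t) ` stefan_region T s) \<and>
     heat_equation_on (stefan_interior T s) u \<and>
     (\<forall>t\<in>{0<..T}. u 0 t = 1) \<and>
     (\<forall>t\<in>{0<..T}. u (s t) t = 0) \<and> s 0 = 0 \<and>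
     (\<exists>s'. continuous_on {0<..T} s' \<and>
        (\<forall>t\<in>{0<..T}.
           (s has_real_derivative s' t) (at t within {0..T}) \<and>
           (\<exists>u\<^sub>x. ((\<lambda>x. u x t) has_real_derivative u\<^sub>x) (at (s t) within {0..s t}) \<and>
                 s' t = - u\<^sub>x)))"

definition unique_stefan_solution ::
  "real \<Rightarrow> (real \<Rightarrow> real \<Rightarrow> real) \<Rightarrow> (real \<Rightarrow> real) \<Rightarrow> bool" where
  "unique_stefan_solution T u s \<longleftrightarrow>
     stefan_solution T u s \<and>
     (\<forall>v r. stefan_solution T v r \<longrightarrow>
        (\<forall>t\<in>{0..T}. r t = s t) \<and> (\<forall>(x, t)\<in>stefan_region T s. v x t = u x t))"

end

theory Submission
  imports Defs
begin

text \<open>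
  For \<open>0 \<le> a \<le> 1/2\<close> the reflection formula and log-convexity of \<open>\<Gamma>\<close> give
  \<open>1/\<Gamma>(b - a k) = O(\<surd>(k!))\<close>, so the Wright series is dominated uniformly and
  \<open>W(x, -a, b)\<close> is jointly continuous in \<open>(x, a, b)\<close> up to \<open>a = 1/2\<close>. There it is explicit:
  \<open>W(-x, -1/2, 1/2) = exp(-x\<^sup>2/4)/\<surd>\<pi>\<close> by reindexing the exponential series, and
  \<open>W(-x, -1/2, 1)\<close> and \<open>W(-x, -1/2, 3/2)\<close> follow by integration. Both coefficient
  equations therefore tend pointwise to the classical one, whose two sides differ by a strictly
  increasing function with one sign change; by the intermediate value theorem each fractional
  equation has a root near the classical one, and uniqueness identifies it with
  \<open>\<eta>\<^sub>\<alpha>\<close> or \<open>\<xi>\<^sub>\<alpha>\<close>. The limits form the similarity solution of the classical problem,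
  which is its only solution by assumption.
\<close>

section \<open>Growth of the reciprocal Gamma function\<close>

lemma rGamma_reflection_real:
  "rGamma z * rGamma (1 - z :: real) = sin (pi * z) / pi"
proof -
  have "complex_of_real (rGamma z * rGamma (1 - z)) = of_real (sin (pi * z) / pi)"
    using rGamma_reflection_complex[of "of_real z"]
    by (simp flip: rGamma_complex_of_real sin_of_real)
  then show ?thesis
    by (simp only: of_real_eq_iff)
qed

text \<open>\<open>ln \<circ> Gamma\<close> is convex and vanishes at 1, so between 1 and
  \<open>1 + k\<close> it lies below a chord of slope \<open>ln (fact k) / k\<close>. Staying in the
  first half of that interval costs at most half of \<open>ln (fact k)\<close>, which is the square
  root.\<close>

lemma Gamma_le_sqrt_fact:
  fixes y :: real
  assumes "0 \<le> y" "y \<le> real k / 2"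
  shows "Gamma (1 + y) \<le> sqrt (fact k)"
proof (cases "k = 0")
  case True
  then show ?thesis using assms by simp
next
  case False
  have "(ln \<circ> Gamma) (1 + y) \<le>
      ((ln \<circ> Gamma) (1 + real k) - (ln \<circ> Gamma) 1) / (1 + real k - 1) * (1 + y - 1) + (ln \<circ> Gamma) 1"
    using assms by (intro convex_onD_Icc' convex_on_subset[OF log_convex_Gamma_real]) auto
  also have "\<dots> = ln (fact k) * (y / real k)"
    by (simp add: Gamma_fact[of k, symmetric])
  also have "\<dots> \<le> ln (fact k) * (1 / 2)"
    using assms False by (intro mult_left_mono) (auto simp: field_simps)
  also have "\<dots> = ln (sqrt (fact k))"
    by (simp add: ln_sqrt)
  finally show ?thesis
    using assms by (simp add: Gamma_real_pos)
qed

text \<open>On [0, 2] compactness gives a constant. For negative \<open>z\<close> reflection trades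
  \<open>rGamma z\<close> for \<open>Gamma (1 - z)\<close> times a factor of modulus at most 1, and
  \<open>1 - z\<close> lies in the range of \<open>Gamma_le_sqrt_fact\<close>.\<close>

lemma rGamma_bound:
  obtains C :: real where "0 < C"
    "\<And>k z. - (real k / 2) \<le> z \<Longrightarrow> z \<le> 2 \<Longrightarrow> \<bar>rGamma z\<bar> \<le> C * sqrt (fact k)"
proof -
  have "bounded (rGamma ` {0..2::real})"
    by (intro compact_imp_bounded compact_continuous_image continuous_intros) simp
  then obtain B where B: "\<forall>z\<in>rGamma ` {0..2::real}. \<bar>z\<bar> \<le> B"
    unfolding bounded_iff real_norm_def by blast
  show ?thesis
  proof (rule that[of "max B 1"])
    fix k :: nat and z :: real
    assume z: "- (real k / 2) \<le> z" "z \<le> 2"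
    have one: "1 \<le> sqrt (fact k)" by simp
    show "\<bar>rGamma z\<bar> \<le> max B 1 * sqrt (fact k)"
    proof (cases "0 \<le> z")
      case True
      then have "\<bar>rGamma z\<bar> \<le> max B 1 * 1" using B z by (simp add: le_max_iff_disj)
      also have "\<dots> \<le> max B 1 * sqrt (fact k)"
        using one by (intro mult_left_mono) auto
      finally show ?thesis .
    next
      case False
      then have pos: "0 < Gamma (1 - z)" by (intro Gamma_real_pos) simp
      have "rGamma z = sin (pi * z) / pi * Gamma (1 - z)"
        using rGamma_reflection_real[of z] rGamma_inverse_Gamma[of "1 - z"] pos
        by (simp add: divide_eq_eq flip: divide_inverse)
      then have "\<bar>rGamma z\<bar> = \<bar>sin (pi * z) / pi\<bar> * Gamma (1 - z)"
        using pos by (simp add: abs_mult)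
      also have "\<dots> \<le> 1 * sqrt (fact k)"
      proof (intro mult_mono)
        have "\<bar>sin (pi * z)\<bar> \<le> pi"
          using abs_sin_le_one[of "pi * z"] pi_ge_two by linarith
        then show "\<bar>sin (pi * z) / pi\<bar> \<le> 1" by simp
        show "Gamma (1 - z) \<le> sqrt (fact k)"
          using Gamma_le_sqrt_fact[of "-z" k] False z by simp
      qed (use pos in auto)
      also have "\<dots> \<le> max B 1 * sqrt (fact k)"
        using one by (intro mult_right_mono) auto
      finally show ?thesis .
    qed
  qed simp
qed

section \<open>Domination, continuity and differentiation of the Wright series\<close>

lemma summable_power_over_sqrt_fact: "summable (\<lambda>k. x ^ k / sqrt (fact k))" for x :: real
proof -
  \<comment> \<open>The ratio of consecutive terms is \<open>\<bar>x\<bar> / sqrt (Suc k)\<close>;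
    from this \<open>N\<close> on it is at most 1/2.\<close>
  obtain N :: nat where N: "4 * x\<^sup>2 \<le> real N"
    using real_arch_simple by blast
  show ?thesis
  proof (rule summable_ratio_test[of "1/2" N])
    fix k assume "N \<le> k"
    have "norm (x ^ Suc k / sqrt (fact (Suc k))) = \<bar>x\<bar> / sqrt (real (Suc k)) * norm (x ^ k / sqrt (fact k))"
      by (simp add: real_sqrt_mult abs_mult power_abs)
    also have "\<dots> \<le> 1 / 2 * norm (x ^ k / sqrt (fact k))"
    proof (rule mult_right_mono)
      have "(2 * \<bar>x\<bar>)\<^sup>2 \<le> real (Suc k)"
        using N \<open>N \<le> k\<close> by (simp add: power_mult_distrib)
      then have "2 * \<bar>x\<bar> \<le> sqrt (real (Suc k))"
        by (rule real_le_rsqrt)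
      then show "\<bar>x\<bar> / sqrt (real (Suc k)) \<le> 1 / 2"
        by (simp add: field_simps)
    qed simp
    finally show "norm (x ^ Suc k / sqrt (fact (Suc k))) \<le> 1 / 2 * norm (x ^ k / sqrt (fact k))" .
  qed simp
qed

text \<open>The factorial in the denominator absorbs the growth \<open>sqrt (fact k)\<close> of
  \<open>rGamma\<close> and leaves one such root to spare. The quantifier order matters: a single
  \<open>C\<close> serves all parameters, as a dominating series requires.\<close>

lemma Wright_term_bound:
  "\<exists>C. \<forall>x R a b k. \<bar>x\<bar> \<le> R \<and> 0 \<le> a \<and> a \<le> 1/2 \<and> 0 \<le> b \<and> b \<le> 2 \<longrightarrow>
       norm (x ^ k / fact k * rGamma (- a * real k + b)) \<le> C * (R ^ k / sqrt (fact k))"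
proof -
  obtain C :: real where C: "0 < C"
    "\<And>k z. - (real k / 2) \<le> z \<Longrightarrow> z \<le> 2 \<Longrightarrow> \<bar>rGamma z\<bar> \<le> C * sqrt (fact k)"
    using rGamma_bound by blast
  show ?thesis
  proof (intro exI allI impI)
    fix x R a b :: real and k :: nat
    assume *: "\<bar>x\<bar> \<le> R \<and> 0 \<le> a \<and> a \<le> 1/2 \<and> 0 \<le> b \<and> b \<le> 2"
    have ak: "0 \<le> a * real k" "a * real k \<le> 1 / 2 * real k"
      using * mult_right_mono[of a "1/2" "real k"] by auto
    have "norm (x ^ k / fact k * rGamma (- a * real k + b))
        = \<bar>x\<bar> ^ k / fact k * \<bar>rGamma (- a * real k + b)\<bar>"
      by (simp add: abs_mult power_abs)
    also have "\<dots> \<le> R ^ k / fact k * (C * sqrt (fact k))"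
    proof (rule mult_mono)
      show "\<bar>x\<bar> ^ k / fact k \<le> R ^ k / fact k"
        using * by (intro divide_right_mono power_mono) auto
      show "\<bar>rGamma (- a * real k + b)\<bar> \<le> C * sqrt (fact k)"
        using * ak by (intro C(2)) linarith+
    qed (use * in auto)
    also have "\<dots> = C * (R ^ k / sqrt (fact k))"
      by (simp add: field_simps flip: power2_eq_square)
    finally show "norm (x ^ k / fact k * rGamma (- a * real k + b)) \<le> C * (R ^ k / sqrt (fact k))" .
  qed
qed

lemma summable_Wright:
  assumes "0 \<le> a" "a \<le> 1/2" "0 \<le> b" "b \<le> 2"
  shows "summable (\<lambda>k. x ^ k / fact k * rGamma (- a * real k + b))"
proof -
  obtain C where
    "\<forall>x R a b k. \<bar>x\<bar> \<le> R \<and> 0 \<le> a \<and> a \<le> 1/2 \<and> 0 \<le> b \<and> b \<le> 2 \<longrightarrow>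
       norm (x ^ k / fact k * rGamma (- a * real k + b)) \<le> C * (R ^ k / sqrt (fact k))"
    using Wright_term_bound by (elim exE)
  note C = this[rule_format]
  show ?thesis
    by (rule summable_comparison_test'[OF summable_mult[OF summable_power_over_sqrt_fact[of "\<bar>x\<bar>"], of C]], rule C)
       (use assms in auto)
qed

text \<open>Tannery's theorem, that is, dominated convergence for series. All three arguments move
  at once because in the application the coefficient of the free boundary varies together with
  \<alpha>.\<close>

lemma tendsto_Wright:
  assumes f: "(f \<longlongrightarrow> x) F" and g: "(g \<longlongrightarrow> a) F" and h: "(h \<longlongrightarrow> b) F"
    and ga: "\<forall>\<^sub>F i in F. 0 \<le> g i \<and> g i \<le> 1/2" and hb: "\<forall>\<^sub>F i in F. 0 \<le> h i \<and> h i \<le> 2"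
  shows "((\<lambda>i. Wright (f i) (- g i) (h i)) \<longlongrightarrow> Wright x (- a) b) F"
proof -
  obtain C where
    "\<forall>x R a b k. \<bar>x\<bar> \<le> R \<and> 0 \<le> a \<and> a \<le> 1/2 \<and> 0 \<le> b \<and> b \<le> 2 \<longrightarrow>
       norm (x ^ k / fact k * rGamma (- a * real k + b)) \<le> C * (R ^ k / sqrt (fact k))"
    using Wright_term_bound by (elim exE)
  note C = this[rule_format]
  have "((\<lambda>i. \<bar>f i\<bar>) \<longlongrightarrow> \<bar>x\<bar>) F"
    using f by (rule tendsto_rabs)
  \<comment> \<open>A fixed radius \<open>\<bar>x\<bar> + 1\<close> makes the dominating series
    independent of \<open>i\<close>.\<close>
  then have fb: "\<forall>\<^sub>F i in F. \<bar>f i\<bar> < \<bar>x\<bar> + 1"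
    by (rule order_tendstoD) simp
  show ?thesis
  proof (cases "F = bot")
    case False
    show ?thesis
      unfolding Wright_def
    proof (rule tannerys_theorem[THEN conjunct2, THEN conjunct2])
      show "((\<lambda>i. f i ^ k / fact k * rGamma (- g i * real k + h i)) \<longlongrightarrow>
          x ^ k / fact k * rGamma (- a * real k + b)) F" for k
        by (intro tendsto_intros isCont_tendsto_compose[OF isCont_rGamma[OF continuous_ident]] f g h) auto
      show "\<forall>\<^sub>F (k, i) in at_top \<times>\<^sub>F F. norm (f i ^ k / fact k * rGamma (- g i * real k + h i))
          \<le> C * ((\<bar>x\<bar> + 1) ^ k / sqrt (fact k))"
        unfolding eventually_prod_filter
      proof (intro exI conjI allI impI)
        show "\<forall>\<^sub>F i in F. \<bar>f i\<bar> < \<bar>x\<bar> + 1 \<and> (0 \<le> g i \<and> g i \<le> 1/2) \<and> (0 \<le> h i \<and> h i \<le> 2)"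
          using fb ga hb by eventually_elim blast
        fix k i
        assume "\<bar>f i\<bar> < \<bar>x\<bar> + 1 \<and> (0 \<le> g i \<and> g i \<le> 1/2) \<and> (0 \<le> h i \<and> h i \<le> 2)"
        then show "case (k, i) of (k, i) \<Rightarrow> norm (f i ^ k / fact k * rGamma (- g i * real k + h i))
            \<le> C * ((\<bar>x\<bar> + 1) ^ k / sqrt (fact k))"
          unfolding prod.case by (intro C) linarith
      qed (rule eventually_True)
      show "summable (\<lambda>k. C * ((\<bar>x\<bar> + 1) ^ k / sqrt (fact k)))"
        by (intro summable_mult summable_power_over_sqrt_fact)
    qed (fact False)
  qed simp
qed

lemma Wright_0 [simp]: "Wright 0 \<rho> \<beta> = rGamma \<beta>"
proof -
  have "Wright 0 \<rho> \<beta> = (\<Sum>k. (rGamma (\<rho> * real k + \<beta>) / fact k) * 0 ^ k)"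
    by (simp add: Wright_def mult_ac)
  then show ?thesis
    by (simp only: powser_zero) simp
qed

text \<open>Differentiating a term cancels one factor of the factorial and replaces \<open>k\<close>
  by \<open>k + 1\<close> in the Gamma argument, where the extra \<open>- a\<close> is absorbed into
  \<open>b\<close>.\<close>

lemma DERIV_Wright:
  assumes "0 \<le> a" "a \<le> 1/2" "a \<le> b" "b \<le> 2"
  shows "((\<lambda>x. Wright x (- a) b) has_real_derivative Wright x (- a) (b - a)) (at x)"
proof -
  define c where "c k = rGamma (- a * real k + b) / fact k" for k
  have W: "Wright x (- a) b = (\<Sum>k. c k * x ^ k)" for x
    by (simp add: Wright_def c_def mult_ac)
  have "diffs c k = rGamma (- a * real k + (b - a)) / fact k" for k
  proof -
    have "- a * real (Suc k) + b = - a * real k + (b - a)"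
      by (simp add: algebra_simps)
    then show ?thesis
      unfolding diffs_def c_def by (simp only: fact_Suc) (simp del: of_nat_Suc)
  qed
  then have W': "Wright x (- a) (b - a) = (\<Sum>k. diffs c k * x ^ k)" for x
    by (simp add: Wright_def mult_ac)
  have "summable (\<lambda>k. c k * y ^ k)" for y
    using summable_Wright[of a b y] assms by (simp add: c_def mult_ac)
  then show ?thesis
    unfolding W W' by (rule termdiffs_strong_converges_everywhere)
qed

section \<open>Closed forms at \<rho> = -1/2\<close>

lemma rGamma_half_minus: "rGamma (1 / 2 - real j) = (- 1 / 4) ^ j * fact (2 * j) / (fact j * sqrt pi)"
proof (induction j)
  case 0
  show ?case by (simp add: rGamma_inverse_Gamma Gamma_one_half_real inverse_eq_divide)
next
  case (Suc j)
  have "rGamma (1 / 2 - real (Suc j)) = (1 / 2 - real (Suc j)) * rGamma (1 / 2 - real j)"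
    using rGamma_plus1[of "1 / 2 - real (Suc j)"] by (simp add: algebra_simps)
  also have "\<dots> = (- 1 / 4) ^ Suc j * fact (2 * Suc j) / (fact (Suc j) * sqrt pi)"
  proof -
    \<comment> \<open>With \<open>c = Suc j\<close> this is the arithmetic of the induction step:
      1/2 - c equals -1/4 times 2c(2c - 1)/c, the last quotient being the growth of
      \<open>fact (2 * j) / fact j\<close>.\<close>
    have "(1 / 2 - c) * (p * f / (g * r)) = (- 1 / 4) * p * (2 * c * (2 * c - 1) * f) / (c * g * r)"
      if "c \<noteq> 0" for c p f g r :: real
      using that by (cases "g = 0"; cases "r = 0"; simp add: field_simps)
    moreover have "fact (2 * Suc j) = 2 * real (Suc j) * (2 * real (Suc j) - 1) * fact (2 * j)"
      by (simp add: algebra_simps)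
    moreover have "fact (Suc j) = real (Suc j) * fact j"
      by simp
    moreover have "real (Suc j) \<noteq> 0"
      by simp
    ultimately show ?thesis
      unfolding Suc power_Suc by metis
  qed
  finally show ?case .
qed

lemma rGamma_three_halves: "rGamma (3 / 2 :: real) = 2 / sqrt pi"
  using rGamma_plus1[of "1 / 2 :: real"] rGamma_half_minus[of 0] by simp

lemma Gamma_three_halves: "Gamma (3 / 2 :: real) = sqrt pi / 2"
  using rGamma_three_halves by (metis inverse_divide inverse_inverse_eq rGamma_inverse_Gamma)

text \<open>For odd \<open>k\<close> the Gamma argument is a pole and the term vanishes. For
  \<open>k = 2 * j\<close> the factor \<open>fact (2 * j)\<close> cancels against
  \<open>rGamma_half_minus\<close>, leaving the exponential series at
  \<open>- x\<^sup>2 / 4\<close>.\<close>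

lemma Wright_half_half: "Wright (- x) (- (1 / 2)) (1 / 2) = exp (- x\<^sup>2 / 4) / sqrt pi"
proof -
  define f where "f k = (- x) ^ k / fact k * rGamma (- (1 / 2) * real k + 1 / 2)" for k
  have odd: "f k = 0" if "k \<notin> range (\<lambda>j. 2 * j)" for k
  proof -
    have "odd k" using that by auto
    then obtain j where "k = 2 * j + 1" by (auto elim: oddE)
    then have "- (1 / 2) * real k + 1 / 2 = - real j" by (simp add: field_simps)
    then have "rGamma (- (1 / 2) * real k + 1 / 2) = 0"
      by (simp only: rGamma_eq_zero_iff) simp
    then show ?thesis by (simp add: f_def)
  qed
  have even: "f (2 * j) = (- x\<^sup>2 / 4) ^ j /\<^sub>R fact j * (1 / sqrt pi)" for j
  proof -
    have "f (2 * j) = x ^ (2 * j) / fact (2 * j) * rGamma (1 / 2 - real j)"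
      by (simp add: f_def)
    also have "\<dots> = (x\<^sup>2 * (- 1 / 4)) ^ j / fact j * (1 / sqrt pi)"
      unfolding rGamma_half_minus power_mult power_mult_distrib by simp
    also have "x\<^sup>2 * (- 1 / 4) = - x\<^sup>2 / 4"
      by simp
    finally show ?thesis
      by (simp only: real_scaleR_def divide_inverse mult_ac mult_1_left)
  qed
  have "(\<lambda>j. f (2 * j)) sums (exp (- x\<^sup>2 / 4) * (1 / sqrt pi))"
    unfolding even by (intro sums_mult2 exp_converges)
  then have "f sums (exp (- x\<^sup>2 / 4) / sqrt pi)"
    \<comment> \<open>The even terms carry the whole sum, since \<open>f\<close> is zero off the
      range of the doubling map.\<close>
    by (subst (asm) sums_mono_reindex) (auto simp: strict_mono_def odd)
  then show ?thesis
    unfolding Wright_def f_def[symmetric] by (rule sums_unique[symmetric])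
qed

text \<open>In terms of the error function, \<open>werf x = erf (x / 2)\<close>.\<close>

definition werf :: "real \<Rightarrow> real" where
  "werf x = 1 - Wright (- x) (- (1 / 2)) 1"

lemma werf_0 [simp]: "werf 0 = 0"
  by (simp add: werf_def)

text \<open>Lowering \<beta> from 1 to 1/2 lands on the Gaussian, and the two minus signs
  cancel.\<close>

lemma DERIV_werf: "(werf has_real_derivative exp (- x\<^sup>2 / 4) / sqrt pi) (at x)"
  unfolding werf_def
  by (rule derivative_eq_intros DERIV_chain2[OF DERIV_Wright] refl | simp add: Wright_half_half)+

lemmas DERIV_werf_chain [derivative_intros] = DERIV_chain2[OF DERIV_werf]

lemma continuous_on_werf [continuous_intros]:
  "continuous_on A f \<Longrightarrow> continuous_on A (\<lambda>x. werf (f x))"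
  by (rule continuous_on_compose2[of UNIV werf])
     (auto intro: DERIV_isCont DERIV_werf continuous_at_imp_continuous_on)

lemma strict_mono_werf: "strict_mono werf"
  by (rule strict_monoI, rule DERIV_pos_imp_increasing) (auto intro!: DERIV_werf)

lemma werf_pos: "0 < x \<Longrightarrow> 0 < werf x"
  using strict_monoD[OF strict_mono_werf, of 0 x] by simp

text \<open>The left side is the limit form of the right side of the \<xi> equation. Differentiating
  the difference, the \<beta> = 1 terms cancel and the \<beta> = 1/2 term is the Gaussian; at 0 both
  sides equal \<open>2 / sqrt pi\<close>.\<close>

lemma Wright_half_three_halves:
  "x * Wright (- x) (- (1 / 2)) 1 + Wright (- x) (- (1 / 2)) (1 + 1 / 2)
     = 2 * exp (- x\<^sup>2 / 4) / sqrt pi"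
proof -
  define f where "f x = x * Wright (- x) (- (1 / 2)) 1 + Wright (- x) (- (1 / 2)) (3 / 2)
     - 2 * exp (- x\<^sup>2 / 4) / sqrt pi" for x
  have "(f has_real_derivative 0) (at x)" for x
    unfolding f_def
    by (rule derivative_eq_intros DERIV_chain2[OF DERIV_Wright] refl
        | simp add: Wright_half_half field_simps)+
  then have "f x = f 0"
    by (intro DERIV_isconst_all) auto
  also have "f 0 = 0"
    by (simp add: f_def rGamma_three_halves)
  finally show ?thesis
    by (simp add: f_def)
qed

section \<open>Stability of roots, and the coefficient of the classical free boundary\<close>

lemma continuous_on_Wright:
  assumes "0 \<le> a" "a \<le> 1/2" "0 \<le> b" "b \<le> 2" "continuous_on A f"
  shows "continuous_on A (\<lambda>x. Wright (f x) (- a) b)"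
  using assms unfolding continuous_on_def by (auto intro!: tendsto_Wright tendsto_const)

text \<open>Pointwise convergence at one point on each side of \<open>c\<close> fixes the signs of
  \<open>G i\<close> there. The intermediate value theorem then yields a root in between, and
  \<open>uniq\<close> identifies it with \<open>z i\<close>.\<close>

lemma tendsto_root_sign_change:
  fixes G :: "'a \<Rightarrow> real \<Rightarrow> real"
  assumes lim: "\<And>x. 0 < x \<Longrightarrow> ((\<lambda>i. G i x) \<longlongrightarrow> H x) F"
    and neg: "\<And>x. 0 < x \<Longrightarrow> x < c \<Longrightarrow> H x < 0" and pos: "\<And>x. c < x \<Longrightarrow> 0 < H x"
    and c: "0 < c"
    and cont: "\<forall>\<^sub>F i in F. continuous_on {0<..} (G i)"
    and uniq: "\<forall>\<^sub>F i in F. \<forall>x>0. G i x = 0 \<longrightarrow> x = z i"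
  shows "(z \<longlongrightarrow> c) F"
proof -
  have between: "\<forall>\<^sub>F i in F. a \<le> z i \<and> z i \<le> b" if ab: "0 < a" "a < c" "c < b" for a b
  proof -
    have "\<forall>\<^sub>F i in F. G i a < 0" "\<forall>\<^sub>F i in F. 0 < G i b"
      using lim[of a] neg[of a] lim[of b] pos[of b] ab by (auto dest: order_tendstoD)
    then show ?thesis
      using cont uniq
    proof eventually_elim
      case (elim i)
      have "continuous_on {a..b} (G i)"
        using elim(3) by (rule continuous_on_subset) (use ab in auto)
      then obtain x where "a \<le> x" "x \<le> b" "G i x = 0"
        using IVT'[of "G i" a 0 b] elim ab by force
      then show ?case
        using elim(4)[rule_format, of x] ab by auto
    qed
  qed
  show ?thesis
  proof (rule order_tendstoI)
    fix l assume "l < c"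
    \<comment> \<open>\<open>max l 0\<close> keeps \<open>a\<close> positive, where
      \<open>lim\<close> applies; the other endpoint \<open>c + 1\<close> is an arbitrary point
      beyond \<open>c\<close>.\<close>
    then obtain a where "max l 0 < a" "a < c"
      using c dense[of "max l 0" c] by auto
    then show "\<forall>\<^sub>F i in F. l < z i"
      using between[of a "c + 1"] by (auto elim: eventually_mono)
  next
    fix r assume "c < r"
    then obtain b where "c < b" "b < r"
      using dense by blast
    then show "\<forall>\<^sub>F i in F. z i < r"
      using between[of "c / 2" b] c by (auto elim: eventually_mono)
  qed
qed

text \<open>Since \<open>werf (2 * x) = erf x\<close>, this is twice the difference of the two sides
  of the classical equation for \<open>\<eta>\<^sub>1\<close>. The factor 2 matches the limits of
  both fractional equations.\<close>

definition stefan_balance :: "real \<Rightarrow> real" where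
  "stefan_balance x = 2 * x * werf (2 * x) - 2 * exp (- x\<^sup>2) / sqrt pi"

text \<open>On the half line the product of increasing factors grows strictly while the Gaussian
  decreases.\<close>

lemma stefan_balance_less:
  assumes "0 \<le> x" "x < y"
  shows "stefan_balance x < stefan_balance y"
proof -
  have "werf (2 * x) \<le> werf (2 * y)" "0 \<le> werf (2 * x)" "0 < werf (2 * y)"
    using assms strict_mono_less_eq[OF strict_mono_werf, of "2 * x" "2 * y"]
      strict_mono_less_eq[OF strict_mono_werf, of 0 "2 * x"] werf_pos[of "2 * y"] by auto
  then have "2 * x * werf (2 * x) \<le> 2 * x * werf (2 * y)" "2 * x * werf (2 * y) < 2 * y * werf (2 * y)"
    using assms by (auto intro!: mult_left_mono)
  moreover have "exp (- y\<^sup>2) / sqrt pi \<le> exp (- x\<^sup>2) / sqrt pi"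
    using assms by (intro divide_right_mono) (auto intro!: power_mono)
  ultimately show ?thesis
    by (simp add: stefan_balance_def)
qed

lemma stefan_balance_root:
  obtains c where "0 < c" "stefan_balance c = 0"
proof -
  \<comment> \<open>Chosen so that \<open>2 * M * werf 2\<close> exceeds \<open>2 / sqrt pi\<close>,
    the maximum of the Gaussian term, by \<open>2 * werf 2\<close>.\<close>
  define M where "M = 1 + 1 / (sqrt pi * werf 2)"
  have w2: "0 < werf 2" by (rule werf_pos) simp
  have M: "1 \<le> M" using w2 by (simp add: M_def)
  have "2 / sqrt pi < 2 * M * werf 2"
    using w2 by (simp add: M_def field_simps)
  also have "\<dots> \<le> 2 * M * werf (2 * M)"
    using M strict_mono_less_eq[OF strict_mono_werf, of 2 "2 * M"] by (intro mult_left_mono) auto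
  finally have "2 / sqrt pi < 2 * M * werf (2 * M)" .
  moreover have "2 * exp (- M\<^sup>2) / sqrt pi \<le> 2 / sqrt pi"
    by (intro divide_right_mono) auto
  ultimately have "0 \<le> stefan_balance M"
    by (simp add: stefan_balance_def)
  moreover have neg: "stefan_balance 0 < 0"
    by (simp add: stefan_balance_def)
  moreover have "continuous_on {0..M} stefan_balance"
    unfolding stefan_balance_def by (intro continuous_intros) auto
  ultimately obtain c where "0 \<le> c" "stefan_balance c = 0"
    using IVT'[of stefan_balance 0 0 M] M by force
  with neg show ?thesis
    using that[of c] by (cases "c = 0") auto
qed

section \<open>The similarity solution of the classical Stefan problem\<close>

lemma stefan_solution_similarity:
  assumes T: "0 < T" and c: "0 < c" "stefan_balance c = 0"
  shows "stefan_solution T (\<lambda>x t. 1 - werf (x / sqrt t) / werf (2 * c)) (\<lambda>t. 2 * c * sqrt t)"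
    (is "stefan_solution T ?u ?s")
proof -
  define E where "E = werf (2 * c)"
  have E: "0 < E" using c werf_pos[of "2 * c"] by (simp add: E_def)
  have bal: "c * E = exp (- c\<^sup>2) / sqrt pi"
    using c by (simp add: stefan_balance_def E_def)
  have heat: "heat_equation_on (stefan_interior T ?s) (\<lambda>x t. 1 - werf (x / sqrt t) / E)"
  proof -
    define u\<^sub>x :: "real \<Rightarrow> real \<Rightarrow> real" where
      "u\<^sub>x x t = - (exp (- (x / sqrt t)\<^sup>2 / 4) / sqrt pi / sqrt t / E)" for x t
    \<comment> \<open>The same formula serves below as the second derivative in \<open>x\<close>;
      that coincidence is the heat equation.\<close>
    define u\<^sub>t :: "real \<Rightarrow> real \<Rightarrow> real" where
      "u\<^sub>t x t = exp (- (x / sqrt t)\<^sup>2 / 4) / sqrt pi * x / (2 * t * sqrt t) / E" for x t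
    have pos: "0 < t" if "(x, t) \<in> stefan_interior T ?s" for x t
      using that by (simp add: stefan_interior_def)
    have "((\<lambda>\<tau>. 1 - werf (x / sqrt \<tau>) / E) has_real_derivative u\<^sub>t x t) (at t) \<and>
          ((\<lambda>y. 1 - werf (y / sqrt t) / E) has_real_derivative u\<^sub>x x t) (at x) \<and>
          ((\<lambda>y. u\<^sub>x y t) has_real_derivative u\<^sub>t x t) (at x)" if "0 < t" for x t
      unfolding u\<^sub>x_def u\<^sub>t_def using that E
      by (intro conjI) (auto intro!: derivative_eq_intros simp: field_simps power2_eq_square)
    moreover have "continuous_on (stefan_interior T ?s) (\<lambda>(x, t). u\<^sub>x x t)"
      "continuous_on (stefan_interior T ?s) (\<lambda>(x, t). u\<^sub>t x t)"
      unfolding u\<^sub>x_def u\<^sub>t_def case_prod_unfold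
      using E by (auto intro!: continuous_intros dest: pos)
    ultimately show ?thesis
      unfolding heat_equation_on_def
      by (intro exI[of _ u\<^sub>t] exI[of _ u\<^sub>x] conjI) (auto dest: pos)
  qed
  have cont: "continuous_on (stefan_region T ?s) (\<lambda>(x, t). 1 - werf (x / sqrt t) / E)"
    unfolding case_prod_unfold stefan_region_def using E
    by (auto intro!: continuous_intros)
  have "bounded ((\<lambda>(x, t). 1 - werf (x / sqrt t) / E) ` stefan_region T ?s)"
    unfolding bounded_iff
  proof (intro exI[of _ 1] ballI)
    fix y assume "y \<in> (\<lambda>(x, t). 1 - werf (x / sqrt t) / E) ` stefan_region T ?s"
    then obtain x t where y: "y = 1 - werf (x / sqrt t) / E"
      and xt: "0 < t" "0 \<le> x" "x \<le> 2 * c * sqrt t"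
      by (auto simp: stefan_region_def)
    \<comment> \<open>The similarity variable stays in \<open>[0, 2c]\<close>, so monotonicity of
      \<open>werf\<close> puts the temperature in \<open>[0, 1]\<close>.\<close>
    have "0 \<le> x / sqrt t" "x / sqrt t \<le> 2 * c"
      using xt by (auto simp: field_simps)
    then have "0 \<le> werf (x / sqrt t)" "werf (x / sqrt t) \<le> E"
      using strict_mono_less_eq[OF strict_mono_werf, of 0 "x / sqrt t"]
        strict_mono_less_eq[OF strict_mono_werf, of "x / sqrt t" "2 * c"] by (auto simp: E_def)
    then show "norm y \<le> 1"
      using E by (simp add: y)
  qed
  moreover have "\<exists>s'. continuous_on {0<..T} s' \<and> (\<forall>t\<in>{0<..T}.
      (?s has_real_derivative s' t) (at t within {0..T}) \<and>
      (\<exists>u\<^sub>x. ((\<lambda>x. 1 - werf (x / sqrt t) / E) has_real_derivative u\<^sub>x) (at (?s t) within {0..?s t}) \<and>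
        s' t = - u\<^sub>x))"
  proof (intro exI[of _ "\<lambda>t. c / sqrt t"] conjI ballI)
    show "continuous_on {0<..T} (\<lambda>t. c / sqrt t)"
      by (intro continuous_intros) auto
    fix t assume t: "t \<in> {0<..T}"
    then show "(?s has_real_derivative c / sqrt t) (at t within {0..T})"
      by (auto intro!: derivative_eq_intros simp: field_simps)
    have "((\<lambda>x. 1 - werf (x / sqrt t) / E) has_real_derivative - (c / sqrt t))
        (at (?s t) within {0..?s t})"
    proof -
      have "((\<lambda>x. 1 - werf (x / sqrt t) / E) has_real_derivative
          - (exp (- c\<^sup>2) / sqrt pi / E / sqrt t)) (at (?s t) within {0..?s t})"
        using t E by (auto intro!: derivative_eq_intros simp: field_simps power2_eq_square)
      \<comment> \<open>On the front the similarity variable is \<open>2 * c\<close>, so the flux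
        carries \<open>exp (- c\<^sup>2)\<close>; the equation for \<open>c\<close> is exactly the
        Stefan condition.\<close>
      also have "exp (- c\<^sup>2) / sqrt pi / E = c"
        using E by (simp flip: bal)
      finally show ?thesis .
    qed
    then show "\<exists>u\<^sub>x. ((\<lambda>x. 1 - werf (x / sqrt t) / E) has_real_derivative u\<^sub>x)
        (at (?s t) within {0..?s t}) \<and> c / sqrt t = - u\<^sub>x"
      by (intro exI[of _ "- (c / sqrt t)"]) simp
  qed
  moreover have "continuous_on {0..T} ?s"
    by (intro continuous_intros)
  moreover have "1 - werf (?s t / sqrt t) / E = 0" if "0 < t" for t
    using that E by (simp add: E_def)
  ultimately show ?thesis
    unfolding stefan_solution_def E_def[symmetric] using heat cont c by auto
qed

section \<open>Passage to the limit \<alpha> to 1 from the left\<close>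

lemma eventually_at_left_1: "\<forall>\<^sub>F \<alpha> in at_left (1::real). 0 < \<alpha> \<and> \<alpha> < 1"
  using eventually_at_left_real[of 0 1] by (auto elim: eventually_mono)

lemma tendsto_Wright_at_left_1:
  assumes "(f \<longlongrightarrow> x) (at_left 1)" "(h \<longlongrightarrow> b) (at_left 1)"
    "\<And>\<alpha>. 0 < \<alpha> \<Longrightarrow> \<alpha> < 1 \<Longrightarrow> 0 \<le> h \<alpha> \<and> h \<alpha> \<le> 2"
  shows "((\<lambda>\<alpha>. Wright (f \<alpha>) (- (\<alpha> / 2)) (h \<alpha>)) \<longlongrightarrow> Wright x (- (1 / 2)) b) (at_left 1)"
proof (rule tendsto_Wright)
  show "((\<lambda>\<alpha>. \<alpha> / 2) \<longlongrightarrow> 1 / 2) (at_left (1::real))"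
    by (intro tendsto_intros) auto
qed (use assms eventually_at_left_1 in \<open>auto elim!: eventually_mono\<close>)

lemma tendsto_werf_at_left_1:
  assumes "(f \<longlongrightarrow> x) (at_left 1)"
  shows "((\<lambda>\<alpha>. 1 - Wright (- f \<alpha>) (- (\<alpha> / 2)) 1) \<longlongrightarrow> werf x) (at_left 1)"
  unfolding werf_def by (intro tendsto_intros tendsto_Wright_at_left_1 assms) auto

text \<open>\<open>?G\<close> is the difference of the two sides of the \<eta> equation. Its limit
  is \<open>stefan_balance\<close>, whose strict growth through the root \<open>c\<close> provides
  the sign change.\<close>

lemma eta_tendsto:
  assumes \<eta>: "\<And>\<alpha>. 0 < \<alpha> \<Longrightarrow> \<alpha> < 1 \<Longrightarrow> unique_positive_solution (eta_equation \<alpha>) (\<eta> \<alpha>)"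
    and c: "0 < c" "stefan_balance c = 0"
  shows "(\<eta> \<longlongrightarrow> c) (at_left 1)"
proof (rule tendsto_root_sign_change)
  let ?G = "\<lambda>\<alpha> x. 2 * x * (1 - Wright (- (2 * x)) (- (\<alpha> / 2)) 1)
    - Mainardi (\<alpha> / 2) (2 * x) * (Gamma (1 - \<alpha> / 2) / Gamma (1 + \<alpha> / 2))"
  show "((\<lambda>\<alpha>. ?G \<alpha> x) \<longlongrightarrow> stefan_balance x) (at_left 1)" for x
  proof -
    have "((\<lambda>\<alpha>. Gamma (1 - \<alpha> / 2) / Gamma (1 + \<alpha> / 2)) \<longlongrightarrow> Gamma (1 - 1 / 2 :: real) / Gamma (1 + 1 / 2)) (at_left 1)"
      by (intro tendsto_intros) (auto elim!: nonpos_Ints_cases' simp: Gamma_eq_zero_iff)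
    \<comment> \<open>The limit is \<open>Gamma (1/2) / Gamma (3/2) = 2\<close>, the source of the
      factor 2 before the Gaussian.\<close>
    then have "((\<lambda>\<alpha>. Gamma (1 - \<alpha> / 2) / Gamma (1 + \<alpha> / 2)) \<longlongrightarrow> 2) (at_left (1::real))"
      by (simp add: Gamma_three_halves Gamma_one_half_real)
    moreover have "((\<lambda>\<alpha>. Mainardi (\<alpha> / 2) (2 * x)) \<longlongrightarrow> Wright (- (2 * x)) (- (1 / 2)) (1 - 1 / 2)) (at_left 1)"
      unfolding Mainardi_def by (intro tendsto_Wright_at_left_1 tendsto_intros) auto
    then have "((\<lambda>\<alpha>. Mainardi (\<alpha> / 2) (2 * x)) \<longlongrightarrow> exp (- x\<^sup>2) / sqrt pi) (at_left 1)"
      by (simp add: Wright_half_half power_mult_distrib)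
    ultimately have "((\<lambda>\<alpha>. ?G \<alpha> x) \<longlongrightarrow> 2 * x * werf (2 * x) - exp (- x\<^sup>2) / sqrt pi * 2) (at_left 1)"
      by (intro tendsto_intros tendsto_werf_at_left_1)
    then show ?thesis
      by (simp add: stefan_balance_def mult_ac)
  qed
  show "\<forall>\<^sub>F \<alpha> in at_left 1. continuous_on {0<..} (?G \<alpha>)"
    using eventually_at_left_1
  proof eventually_elim
    case (elim \<alpha>)
    then have "Gamma (1 + \<alpha> / 2) \<noteq> 0"
      using Gamma_real_pos[of "1 + \<alpha> / 2"] by linarith
    with elim show ?case
      unfolding Mainardi_def by (auto intro!: continuous_intros continuous_on_Wright)
  qed
  show "\<forall>\<^sub>F \<alpha> in at_left 1. \<forall>x>0. ?G \<alpha> x = 0 \<longrightarrow> x = \<eta> \<alpha>"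
    using eventually_at_left_1
    by eventually_elim (use \<eta> in \<open>auto simp: unique_positive_solution_def eta_equation_def\<close>)
qed (use c stefan_balance_less[of _ c] stefan_balance_less[of c] in auto)

lemma xi_tendsto:
  assumes \<xi>: "\<And>\<alpha>. 0 < \<alpha> \<Longrightarrow> \<alpha> < 1 \<Longrightarrow> unique_positive_solution (xi_equation \<alpha>) (\<xi> \<alpha>)"
    and c: "0 < c" "stefan_balance c = 0"
  shows "(\<xi> \<longlongrightarrow> c) (at_left 1)"
proof (rule tendsto_root_sign_change)
  let ?G = "\<lambda>\<alpha> x. 2 * x * (1 - Wright (- (2 * x)) (- (\<alpha> / 2)) 1)
    - (2 * x * Wright (- (2 * x)) (- (\<alpha> / 2)) 1 + Wright (- (2 * x)) (- (\<alpha> / 2)) (1 + \<alpha> / 2))"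
  show "((\<lambda>\<alpha>. ?G \<alpha> x) \<longlongrightarrow> stefan_balance x) (at_left 1)" for x
  proof -
    have "((\<lambda>\<alpha>. ?G \<alpha> x) \<longlongrightarrow> 2 * x * werf (2 * x)
        - (2 * x * Wright (- (2 * x)) (- (1 / 2)) 1 + Wright (- (2 * x)) (- (1 / 2)) (1 + 1 / 2))) (at_left 1)"
      by (intro tendsto_intros tendsto_werf_at_left_1 tendsto_Wright_at_left_1) auto
    \<comment> \<open>At argument \<open>2 * x\<close> the bracket collapses to
      \<open>2 * exp (- x\<^sup>2) / sqrt pi\<close>, so the Riemann-Liouville equation has the same
      limit as the Caputo one.\<close>
    then show ?thesis
      unfolding Wright_half_three_halves by (simp add: stefan_balance_def power_mult_distrib)
  qed
  show "\<forall>\<^sub>F \<alpha> in at_left 1. continuous_on {0<..} (?G \<alpha>)"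
    using eventually_at_left_1
    by eventually_elim (auto intro!: continuous_intros continuous_on_Wright)
  show "\<forall>\<^sub>F \<alpha> in at_left 1. \<forall>x>0. ?G \<alpha> x = 0 \<longrightarrow> x = \<xi> \<alpha>"
    using eventually_at_left_1
    by eventually_elim (use \<xi> in \<open>auto simp: unique_positive_solution_def xi_equation_def\<close>)
qed (use c stefan_balance_less[of _ c] stefan_balance_less[of c] in auto)

lemma tendsto_powr_half_at_left_1:
  assumes "0 < t"
  shows "((\<lambda>\<alpha>. t powr (\<alpha> / 2)) \<longlongrightarrow> sqrt t) (at_left 1)"
proof -
  have "((\<lambda>\<alpha>. t powr (\<alpha> / 2)) \<longlongrightarrow> t powr (1 / 2)) (at_left 1)"
    using assms by (intro tendsto_intros) auto
  then show ?thesis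
    using assms by (simp add: powr_half_sqrt)
qed

lemma frac_front_tendsto:
  assumes "(\<kappa> \<longlongrightarrow> c) (at_left 1)" "0 < t"
  shows "((\<lambda>\<alpha>. frac_front \<alpha> (\<kappa> \<alpha>) t) \<longlongrightarrow> 2 * c * sqrt t) (at_left 1)"
  unfolding frac_front_def by (intro tendsto_intros tendsto_powr_half_at_left_1 assms)

text \<open>Numerator and denominator converge separately, each with a Wright argument that moves
  with \<alpha>; positivity of \<open>werf (2 * c)\<close> lets the quotient converge.\<close>

lemma frac_temp_tendsto:
  assumes "(\<kappa> \<longlongrightarrow> c) (at_left 1)" "0 < t" "0 < c"
  shows "((\<lambda>\<alpha>. frac_temp \<alpha> (\<kappa> \<alpha>) x t) \<longlongrightarrow> 1 - werf (x / sqrt t) / werf (2 * c)) (at_left 1)"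
  unfolding frac_temp_def
  using assms werf_pos[of "2 * c"]
  by (intro tendsto_intros tendsto_werf_at_left_1 tendsto_powr_half_at_left_1) auto

theorem theorem2:
  fixes \<eta> \<xi> :: "real \<Rightarrow> real" and T :: real
    and u :: "real \<Rightarrow> real \<Rightarrow> real" and s :: "real \<Rightarrow> real"
  assumes "\<And>\<alpha>. 0 < \<alpha> \<Longrightarrow> \<alpha> < 1 \<Longrightarrow> unique_positive_solution (eta_equation \<alpha>) (\<eta> \<alpha>)"
    and "\<And>\<alpha>. 0 < \<alpha> \<Longrightarrow> \<alpha> < 1 \<Longrightarrow> unique_positive_solution (xi_equation \<alpha>) (\<xi> \<alpha>)"
    and "0 < T"
    and "unique_stefan_solution T u s"
  shows "\<forall>t x. 0 < t \<and> t \<le> T \<and> 0 \<le> x \<and> x \<le> s t \<longrightarrow>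
           ((\<lambda>\<alpha>. frac_temp \<alpha> (\<eta> \<alpha>) x t) \<longlongrightarrow> u x t) (at_left 1) \<and>
           ((\<lambda>\<alpha>. frac_temp \<alpha> (\<xi> \<alpha>) x t) \<longlongrightarrow> u x t) (at_left 1) \<and>
           ((\<lambda>\<alpha>. frac_front \<alpha> (\<eta> \<alpha>) t) \<longlongrightarrow> s t) (at_left 1) \<and>
           ((\<lambda>\<alpha>. frac_front \<alpha> (\<xi> \<alpha>) t) \<longlongrightarrow> s t) (at_left 1)"
proof (intro allI impI)
  fix t x
  assume tx: "0 < t \<and> t \<le> T \<and> 0 \<le> x \<and> x \<le> s t"
  obtain c where c: "0 < c" "stefan_balance c = 0"
    by (rule stefan_balance_root)
  have *: "(\<eta> \<longlongrightarrow> c) (at_left 1)" "(\<xi> \<longlongrightarrow> c) (at_left 1)"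
    using eta_tendsto[OF assms(1) c] xi_tendsto[OF assms(2) c] by auto
  \<comment> \<open>The assumed uniqueness, applied to the similarity solution, makes the given pair
    explicit at the point under consideration.\<close>
  have "2 * c * sqrt t = s t" "1 - werf (x / sqrt t) / werf (2 * c) = u x t"
    using assms(4) stefan_solution_similarity[OF assms(3) c] tx
    unfolding unique_stefan_solution_def stefan_region_def by fastforce+
  then show "((\<lambda>\<alpha>. frac_temp \<alpha> (\<eta> \<alpha>) x t) \<longlongrightarrow> u x t) (at_left 1) \<and>
           ((\<lambda>\<alpha>. frac_temp \<alpha> (\<xi> \<alpha>) x t) \<longlongrightarrow> u x t) (at_left 1) \<and>
           ((\<lambda>\<alpha>. frac_front \<alpha> (\<eta> \<alpha>) t) \<longlongrightarrow> s t) (at_left 1) \<and>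
           ((\<lambda>\<alpha>. frac_front \<alpha> (\<xi> \<alpha>) t) \<longlongrightarrow> s t) (at_left 1)"
    using frac_front_tendsto[OF *(1), of t] frac_front_tendsto[OF *(2), of t]
      frac_temp_tendsto[OF *(1), of t x] frac_temp_tendsto[OF *(2), of t x] tx c by simp
qed

end
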